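(* No large walled wedge can be explored by a finite deterministic automaton without any pebble (i.e., with $p=0$).
   Context: The oriented grid $\mathbb{Z}\times\mathbb{Z}$ is embedded in the plane (nodes at integer points, edges between nodes at distance 1); nodes are anonymous and every node has ports $N,E,S,W$ pointing North, East, South, West. Given two half-lines $H_1,H_2$ in the plane with a common origin $O$ (an arbitrary point; arbitrary real directions), let $W(H_1,H_2)$ be the closed region swept clockwise from $H_1$ to $H_2$ (half-lines included); the wedge is the subgraph of the grid induced by the grid nodes in $W(H_1,H_2)$. It is large if the clockwise angle $\alpha$ from $H_1$ to $H_2$ satisfies $\pi\le\alpha\le2\pi$. A boundary $H_i$ is a wall if for every grid edge $\{u,v\}$ with $u$ in the wedge, $v$ not in the wedge and $H_i$ meeting the closed segment $[u,v]$, the ports of this edge at $u$ and at $v$ are blocked (cannot be taken); all other ports are free. A wedge is walled if both boundaries are walls. The agent is a finite deterministic (Mealy) automaton carrying $p$ pebbles: at each step it sees which ports at the current node are free, whether a pebble lies there, and how many pebbles it carries; depending on its state and this input it moves through a free port, possibly dropping or picking up a pebble, and changes state. It starts in its initial state at an adversarially chosen node of the wedge. An automaton explores the wedge if for every starting node in the wedge every node of the wedge is eventually visited. *)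

theory Defs
  imports "HOL-Analysis.Analysis"
begin

type_synonym node = "int \<times> int"

datatype port = North | East | South | West

fun neighbour :: "node \<Rightarrow> port \<Rightarrow> node" where
  "neighbour (x, y) North = (x, y + 1)"
| "neighbour (x, y) East = (x + 1, y)"
| "neighbour (x, y) South = (x, y - 1)"
| "neighbour (x, y) West = (x - 1, y)"

definition point :: "node \<Rightarrow> complex" where
  "point u = Complex (real_of_int (fst u)) (real_of_int (snd u))"

definition half_line :: "complex \<Rightarrow> real \<Rightarrow> complex set" where
  "half_line org \<theta> = {org + of_real r * cis \<theta> | r. 0 \<le> r}"

(* Directions are measured counterclockwise from East, so turning clockwise decreases them.
   If the two half-lines coincide, both 0 and 2 * pi are clockwise angles between them. *)
definition clockwise_angle :: "real \<Rightarrow> real \<Rightarrow> real \<Rightarrow> bool" where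
  "clockwise_angle \<theta>1 \<theta>2 \<alpha> \<longleftrightarrow> 0 \<le> \<alpha> \<and> \<alpha> \<le> 2 * pi \<and> cis \<theta>2 = cis (\<theta>1 - \<alpha>)"

definition swept_region :: "complex \<Rightarrow> real \<Rightarrow> real \<Rightarrow> complex set" where
  "swept_region org \<theta>1 \<alpha> = (\<Union>\<phi>\<in>{0..\<alpha>}. half_line org (\<theta>1 - \<phi>))"

definition wedge :: "complex \<Rightarrow> real \<Rightarrow> real \<Rightarrow> node set" where
  "wedge org \<theta>1 \<alpha> = {u. point u \<in> swept_region org \<theta>1 \<alpha>}"

definition large :: "real \<Rightarrow> bool" where
  "large \<alpha> \<longleftrightarrow> pi \<le> \<alpha> \<and> \<alpha> \<le> 2 * pi"

(* An edge between two nodes of the wedge is never blocked, even if it meets a wall. *)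
definition blocked_edge :: "node set \<Rightarrow> complex set set \<Rightarrow> node \<Rightarrow> node \<Rightarrow> bool" where
  "blocked_edge V walls u v \<longleftrightarrow>
     (u \<in> V \<and> v \<notin> V \<or> v \<in> V \<and> u \<notin> V) \<and>
     (\<exists>H\<in>walls. H \<inter> closed_segment (point u) (point v) \<noteq> {})"

definition free_ports :: "node set \<Rightarrow> complex set set \<Rightarrow> node \<Rightarrow> port set" where
  "free_ports V walls u = {d. \<not> blocked_edge V walls u (neighbour u d)}"

datatype pebble_action = Keep | Drop | Pick

(* free ports at the current node, presence of a pebble there, number of pebbles carried *)
type_synonym input = "port set \<times> bool \<times> nat"

record 's automaton =
  initial :: 's
  next_state :: "'s \<Rightarrow> input \<Rightarrow> 's"
  action :: "'s \<Rightarrow> input \<Rightarrow> port \<times> pebble_action"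

definition legal_output :: "input \<Rightarrow> port \<times> pebble_action \<Rightarrow> bool" where
  "legal_output = (\<lambda>(F, peb, c) (d, a).
     d \<in> F \<and> (a = Drop \<longrightarrow> 0 < c) \<and> (a = Pick \<longrightarrow> peb))"

definition pebble_automaton :: "nat \<Rightarrow> 's::finite automaton \<Rightarrow> bool" where
  "pebble_automaton p A \<longleftrightarrow>
     (\<forall>s F peb c. F \<noteq> {} \<and> c \<le> p \<longrightarrow> legal_output (F, peb, c) (action A s (F, peb, c)))"

record 's config =
  state :: 's
  position :: node
  pebbles :: "node \<Rightarrow> nat"
  carried :: nat

definition observe :: "node set \<Rightarrow> complex set set \<Rightarrow> 's config \<Rightarrow> input" where
  "observe V walls C =
     (free_ports V walls (position C), 0 < pebbles C (position C), carried C)"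

(* The pebble action takes place at the node being left. A blocked port is never traversed;
   for a legal automaton staying put happens only at a node without any free port. *)
definition step :: "node set \<Rightarrow> complex set set \<Rightarrow> 's automaton \<Rightarrow> 's config \<Rightarrow> 's config" where
  "step V walls A C =
     (let i = observe V walls C; u = position C; k = pebbles C; c = carried C;
          (d, a) = action A (state C) i
      in \<lparr>state = next_state A (state C) i,
          position = (if d \<in> free_ports V walls u then neighbour u d else u),
          pebbles = (case a of Keep \<Rightarrow> k | Drop \<Rightarrow> k(u := k u + 1) | Pick \<Rightarrow> k(u := k u - 1)),
          carried = (case a of Keep \<Rightarrow> c | Drop \<Rightarrow> c - 1 | Pick \<Rightarrow> c + 1)\<rparr>)"

definition start_config :: "nat \<Rightarrow> 's automaton \<Rightarrow> node \<Rightarrow> 's config" where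
  "start_config p A u =
     \<lparr>state = initial A, position = u, pebbles = (\<lambda>_. 0), carried = p\<rparr>"

definition explores :: "node set \<Rightarrow> complex set set \<Rightarrow> nat \<Rightarrow> 's automaton \<Rightarrow> bool" where
  "explores V walls p A \<longleftrightarrow>
     (\<forall>u\<in>V. \<forall>v\<in>V. \<exists>t. position ((step V walls A ^^ t) (start_config p A u)) = v)"

end

(* Since the angle is at least pi, the wedge contains a half-plane "f > c", and inside it the
   agent sees no blocked port, so it runs there as an input-free finite automaton: the states
   become periodic and the path stays within a constant distance K of a uniform linear motion.
   An excursion into "f > c" that comes back starts and ends near "f = c", so by linearity f is
   bounded on it by a constant independent of the excursion.  Hence either the agent returns
   for ever and f is bounded on all visited nodes, or from some moment on it remains in a strip
   around a line.  Either way it misses a node of the half-plane. *)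

theory Submission
  imports Defs
begin

definition lin :: "real \<Rightarrow> real \<Rightarrow> node \<Rightarrow> real" where
  "lin a b u = a * real_of_int (fst u) + b * real_of_int (snd u)"

lemma lin_neighbour: "lin a b (neighbour u d) = lin a b u + lin a b (neighbour (0, 0) d)"
  by (cases u; cases d) (simp_all add: lin_def algebra_simps)

lemma lin_neighbour_le:
  assumes "\<bar>a\<bar> \<le> 1" "\<bar>b\<bar> \<le> 1"
  shows "\<bar>lin a b (neighbour u d) - lin a b u\<bar> \<le> 1"
  using assms by (cases u; cases d) (simp_all add: lin_def algebra_simps)

lemma lin_scale: "lin a b (int k * p, int k * q) = real k * lin a b (p, q)"
  by (simp add: lin_def algebra_simps)

section \<open>Mean growth along the orbits of a finite map\<close>

text \<open>The orbit of \<open>s\<close> is eventually periodic, so the sums gain the same amount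
  over every period. With \<open>w\<close> the mean gain per step over one period, the deviation
  from \<open>real i * w\<close> is eventually periodic too, hence bounded.\<close>

lemma finite_iteration_linear_growth:
  fixes g :: "'s::finite \<Rightarrow> 's" and q :: "'s \<Rightarrow> real"
  shows "\<exists>w K. \<forall>i. \<bar>(\<Sum>j<i. q ((g ^^ j) s)) - real i * w\<bar> \<le> K"
proof -
  have "\<not> inj (\<lambda>i. (g ^^ i) s)"
    using finite_imageD[of "\<lambda>i. (g ^^ i) s" UNIV] infinite_UNIV_nat finite by blast
  then obtain m n where "m < n" and mn: "(g ^^ m) s = (g ^^ n) s"
    unfolding inj_def by (metis linorder_neqE_nat)
  then obtain l where l: "n = m + l" "l > 0"
    using less_imp_add_positive by blast
  define Q where "Q i = (\<Sum>j<i. q ((g ^^ j) s))" for i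
  define w where "w = (Q (m + l) - Q m) / real l"
  define D where "D i = Q i - real i * w" for i
  have per: "(g ^^ (m + k + l)) s = (g ^^ (m + k)) s" for k
  proof -
    have "(g ^^ (k + n)) s = (g ^^ (k + m)) s" by (simp add: funpow_add mn)
    then show ?thesis by (simp add: l add_ac)
  qed
  have Dper: "D (m + k + l) = D (m + k)" for k
  proof (induction k)
    case 0
    have "real l * w = Q (m + l) - Q m" using l by (simp add: w_def)
    then show ?case by (simp add: D_def algebra_simps)
  next
    case (Suc k)
    then show ?case using per[of k] by (simp add: D_def Q_def algebra_simps)
  qed
  \<comment> \<open>Subtracting the period \<open>l\<close> repeatedly brings any index below
    \<open>m + l\<close>.\<close>
  have "D i \<in> D ` {..<m + l}" for i
  proof (induction i rule: less_induct)
    case (less i)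
    show ?case
    proof (cases "i < m + l")
      case False
      then have "D i = D (i - l)" using Dper[of "i - l - m"] by simp
      then show ?thesis using less[of "i - l"] False l by simp
    qed auto
  qed
  then have "\<bar>D i\<bar> \<le> Max (abs ` D ` {..<m + l})" for i
    by (intro Max_ge) auto
  then show ?thesis unfolding D_def Q_def by blast
qed

lemma finite_iteration_linear_growth_uniform:
  fixes g :: "'s::finite \<Rightarrow> 's" and q :: "'s \<Rightarrow> real"
  shows "\<exists>w K. \<forall>s i. \<bar>(\<Sum>j<i. q ((g ^^ j) s)) - real i * w s\<bar> \<le> K"
proof -
  have "\<forall>s. \<exists>w K. \<forall>i. \<bar>(\<Sum>j<i. q ((g ^^ j) s)) - real i * w\<bar> \<le> K"
    using finite_iteration_linear_growth by blast
  then obtain w K where wK: "\<And>s i. \<bar>(\<Sum>j<i. q ((g ^^ j) s)) - real i * w s\<bar> \<le> K s"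
    by metis
  have "K s \<le> Max (range K)" for s by simp
  then show ?thesis using wK order_trans by blast
qed

text \<open>A nonzero form vanishes on at most one of (1,0), (0,1), (1,1), so two forms cannot rule
  out all three vectors. A change of sign then makes the first form positive.\<close>

lemma common_direction:
  fixes a b a' b' :: real
  assumes "a \<noteq> 0 \<or> b \<noteq> 0" "a' \<noteq> 0 \<or> b' \<noteq> 0"
  obtains p q :: int where "lin a b (p, q) > 0" "lin a' b' (p, q) \<noteq> 0"
proof -
  have "\<exists>p q. lin a b (p, q) \<noteq> 0 \<and> lin a' b' (p, q) \<noteq> 0"
  proof (rule ccontr)
    assume "\<not> ?thesis"
    then have *: "lin a b (p, q) = 0 \<or> lin a' b' (p, q) = 0" for p q by blast
    show False
      using *[of 1 0] *[of 0 1] *[of 1 1] assms by (auto simp: lin_def)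
  qed
  then obtain p q where "lin a b (p, q) \<noteq> 0" "lin a' b' (p, q) \<noteq> 0" by blast
  moreover have "lin r s (- p, - q) = - lin r s (p, q)" for r s
    by (simp add: lin_def)
  ultimately show thesis
    using that[of p q] that[of "- p" "- q"] by (metis linorder_neqE_linordered_idom neg_0_less_iff_less neg_equal_0_iff_equal)
qed

text \<open>Supplies the node that the agent misses: far inside the half-plane and outside a given
  strip. Large multiples of a common direction do both.\<close>

lemma unbounded_node:
  fixes a b a' b' :: real
  assumes "a \<noteq> 0 \<or> b \<noteq> 0" "a' \<noteq> 0 \<or> b' \<noteq> 0"
  shows "\<exists>u. lin a b u > B \<and> \<bar>lin a' b' u\<bar> > B'"
proof -
  obtain p q where pq: "lin a b (p, q) > 0" "lin a' b' (p, q) \<noteq> 0"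
    using common_direction[OF assms] .
  obtain k where k: "real k * lin a b (p, q) > B"
    using pq(1) reals_Archimedean3 by blast
  obtain k' where k': "real k' * \<bar>lin a' b' (p, q)\<bar> > B'"
    using pq(2) reals_Archimedean3[of "\<bar>lin a' b' (p, q)\<bar>"] by auto
  let ?k = "max k k'"
  have "real ?k * lin a b (p, q) > B"
    using k pq(1) mult_right_mono[of "real k" "real ?k" "lin a b (p, q)"] by linarith
  moreover have "real ?k * \<bar>lin a' b' (p, q)\<bar> > B'"
    using k' mult_right_mono[of "real k'" "real ?k" "\<bar>lin a' b' (p, q)\<bar>"] by linarith
  ultimately show ?thesis
    by (intro exI[of _ "(int ?k * p, int ?k * q)"]) (simp only: lin_scale abs_mult abs_of_nat)
qed

section \<open>Walks that run freely in a half-plane\<close>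

text \<open>Where \<open>lin a b\<close> is at most \<open>c\<close> the walk is arbitrary except
  that it climbs by at most 1 per step, so its behaviour near the walls need not be
  analysed.\<close>

lemma free_run_misses_node:
  fixes X :: "nat \<Rightarrow> node" and st :: "nat \<Rightarrow> 's::finite" and g :: "'s \<Rightarrow> 's" and \<delta> :: "'s \<Rightarrow> port"
  assumes ab: "a \<noteq> 0 \<or> b \<noteq> 0"
    and slow: "\<And>t. lin a b (X (Suc t)) \<le> lin a b (X t) + 1"
    and free: "\<And>t. lin a b (X t) > c \<Longrightarrow>
                 st (Suc t) = g (st t) \<and> X (Suc t) = neighbour (X t) (\<delta> (st t))"
  shows "\<exists>u. lin a b u > c' \<and> (\<forall>t. X t \<noteq> u)"
proof -
  \<comment> \<open>\<open>(wx s, wy s)\<close> is the mean velocity of the free run from state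
    \<open>s\<close>.\<close>
  obtain wx Kx where wx: "\<And>s i.
      \<bar>(\<Sum>j<i. lin 1 0 (neighbour (0, 0) (\<delta> ((g ^^ j) s)))) - real i * wx s\<bar> \<le> Kx"
    using finite_iteration_linear_growth_uniform[of "\<lambda>s. lin 1 0 (neighbour (0, 0) (\<delta> s))" g] by blast
  obtain wy Ky where wy: "\<And>s i.
      \<bar>(\<Sum>j<i. lin 0 1 (neighbour (0, 0) (\<delta> ((g ^^ j) s)))) - real i * wy s\<bar> \<le> Ky"
    using finite_iteration_linear_growth_uniform[of "\<lambda>s. lin 0 1 (neighbour (0, 0) (\<delta> s))" g] by blast
  \<comment> \<open>The error depends on neither \<open>t\<close> nor \<open>i\<close>. Only the
    positions before time \<open>t + i\<close> must lie above \<open>c\<close>, so the bound also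
    covers the step that leaves the half-plane.\<close>
  have drift: "\<bar>lin p q (X (t + i)) - lin p q (X t) - real i * (p * wx (st t) + q * wy (st t))\<bar>
      \<le> \<bar>p\<bar> * Kx + \<bar>q\<bar> * Ky"
    if out: "\<And>j. j < i \<Longrightarrow> lin a b (X (t + j)) > c" for p q t i
  proof -
    have run: "st (t + k) = (g ^^ k) (st t) \<and>
        lin p' q' (X (t + k)) = lin p' q' (X t) +
          (\<Sum>j<k. lin p' q' (neighbour (0, 0) (\<delta> ((g ^^ j) (st t)))))"
      if "k \<le> i" for k p' q'
      using that
    proof (induction k)
      case (Suc k)
      then show ?case
        using free[OF out[of k]] lin_neighbour[of p' q' "X (t + k)"] by simp
    qed simp
    let ?x = "lin 1 0 (X (t + i)) - lin 1 0 (X t) - real i * wx (st t)"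
    let ?y = "lin 0 1 (X (t + i)) - lin 0 1 (X t) - real i * wy (st t)"
    have "\<bar>?x\<bar> \<le> Kx" "\<bar>?y\<bar> \<le> Ky"
      using run[of i] wx[where s = "st t" and i = i] wy[where s = "st t" and i = i] by simp_all
    then have "\<bar>p * ?x + q * ?y\<bar> \<le> \<bar>p\<bar> * Kx + \<bar>q\<bar> * Ky"
      by (intro order_trans[OF abs_triangle_ineq] add_mono) (simp_all add: abs_mult mult_left_mono)
    moreover have "p * ?x + q * ?y =
        lin p q (X (t + i)) - lin p q (X t) - real i * (p * wx (st t) + q * wy (st t))"
      by (simp add: lin_def algebra_simps)
    ultimately show ?thesis by simp
  qed
  show ?thesis
  proof (cases "\<forall>t. \<exists>t1\<ge>t. lin a b (X t1) \<le> c")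
    case True
    \<comment> \<open>An excursion begins at time 0 or one step after a value at most
      \<open>c\<close>; \<open>M\<close> bounds its first value in both cases.\<close>
    define M where "M = max (lin a b (X 0)) (c + 1)"
    define K where "K = \<bar>a\<bar> * Kx + \<bar>b\<bar> * Ky"
    have entry: "\<exists>t0\<le>t. lin a b (X t0) \<le> M \<and> (\<forall>j. t0 \<le> j \<longrightarrow> j < t \<longrightarrow> lin a b (X j) > c)" for t
    proof (induction t)
      case 0
      then show ?case by (simp add: M_def)
    next
      case (Suc t)
      show ?case
      proof (cases "lin a b (X t) \<le> c")
        case True
        then have "lin a b (X (Suc t)) \<le> M" using slow[of t] by (simp add: M_def)
        then show ?thesis by (intro exI[of _ "Suc t"]) simp
      next
        case False
        then show ?thesis using Suc by (metis le_SucI less_SucE not_le)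
      qed
    qed
    have bound: "lin a b (X t) \<le> M + 2 * K" for t
    proof -
      obtain t0 where t0: "t0 \<le> t" "lin a b (X t0) \<le> M"
          "\<And>j. t0 \<le> j \<Longrightarrow> j < t \<Longrightarrow> lin a b (X j) > c"
        using entry by blast
      define t1 where "t1 = (LEAST t1. t \<le> t1 \<and> lin a b (X t1) \<le> c)"
      have t1: "t \<le> t1" "lin a b (X t1) \<le> c"
        using LeastI_ex[of "\<lambda>t1. t \<le> t1 \<and> lin a b (X t1) \<le> c"] True by (auto simp: t1_def)
      have before: "lin a b (X j) > c" if "t \<le> j" "j < t1" for j
        using not_less_Least[of j] that unfolding t1_def by fastforce
      let ?w = "a * wx (st t0) + b * wy (st t0)"
      have "lin a b (X (t0 + j)) > c" if "j < t1 - t0" for j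
        using that t0(3)[of "t0 + j"] before[of "t0 + j"] by linarith
      then have d1: "\<bar>lin a b (X t1) - lin a b (X t0) - real (t1 - t0) * ?w\<bar> \<le> K"
        using drift[of "t1 - t0" t0 a b] t0(1) t1(1) by (simp add: K_def)
      have d: "\<bar>lin a b (X t) - lin a b (X t0) - real (t - t0) * ?w\<bar> \<le> K"
        using drift[of "t - t0" t0 a b] t0 by (simp add: K_def)
      have "c \<le> M" by (simp add: M_def)
      \<comment> \<open>A nonnegative drift is compared with the end of the excursion at
        \<open>t1\<close>, a negative one with its beginning at \<open>t0\<close>.\<close>
      show ?thesis
      proof (cases "?w \<ge> 0")
        case True
        then have "real (t - t0) * ?w \<le> real (t1 - t0) * ?w"
          using t1(1) by (intro mult_right_mono) simp_all
        then show ?thesis using d d1 t1(2) \<open>c \<le> M\<close> by linarith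
      next
        case False
        then have "real (t - t0) * ?w \<le> 0" by (intro mult_nonneg_nonpos) simp_all
        then show ?thesis using d t0(2) by linarith
      qed
    qed
    obtain u where "lin a b u > max c' (M + 2 * K)"
      using unbounded_node[OF ab ab] by blast
    then show ?thesis using bound by (intro exI[of _ u]) (metis max_less_iff_conj not_le)
  next
    case False
    then obtain t where t: "\<And>i. lin a b (X (t + i)) > c"
      by (meson le_add1 not_le)
    \<comment> \<open>The vector \<open>(p, q)\<close> is orthogonal to the final mean velocity, so
      \<open>lin p q\<close> has no drift and stays bounded.\<close>
    obtain p q where pq: "p \<noteq> 0 \<or> q \<noteq> 0" "p * wx (st t) + q * wy (st t) = 0"
    proof (cases "wx (st t) = 0")
      case True
      then show ?thesis using that[of 1 0] by simp
    next
      case False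
      then show ?thesis using that[of "- wy (st t)" "wx (st t)"] by simp
    qed
    define B where "B = Max ((\<lambda>i. \<bar>lin p q (X i)\<bar>) ` {..t})"
    define K where "K = \<bar>p\<bar> * Kx + \<bar>q\<bar> * Ky"
    have early: "\<bar>lin p q (X i)\<bar> \<le> B" if "i \<le> t" for i
      using that by (simp add: B_def)
    have late: "\<bar>lin p q (X (t + i))\<bar> \<le> B + K" for i
      using drift[of i t p q] t early[of t] pq(2) by (simp add: K_def)
    have all: "\<bar>lin p q (X i)\<bar> \<le> max B (B + K)" for i
      using early[of i] late[of "i - t"] by (cases "i \<le> t") auto
    obtain u where "lin a b u > c'" "\<bar>lin p q u\<bar> > max B (B + K)"
      using unbounded_node[OF ab pq(1)] by blast
    then show ?thesis using all by (intro exI[of _ u]) (metis not_le)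
  qed
qed

section \<open>The half-plane inside a large wedge\<close>

text \<open>Rotating by \<open>pi - \<theta>\<close> about \<open>org\<close> turns the first
  boundary into the negative real axis and the half-plane clockwise of it into the upper one. A
  point with argument \<open>Arg w\<close> there is swept at angle \<open>pi - Arg w\<close>, which
  is at most \<open>pi\<close>.\<close>

lemma large_wedge_contains_half_plane:
  assumes "pi \<le> \<alpha>" "lin (sin \<theta>) (- cos \<theta>) u > Im (org * cis (pi - \<theta>))"
  shows "u \<in> wedge org \<theta> \<alpha>"
proof -
  define w where "w = (point u - org) * cis (pi - \<theta>)"
  have "Im w = lin (sin \<theta>) (- cos \<theta>) u - Im (org * cis (pi - \<theta>))"
    by (simp add: w_def point_def lin_def algebra_simps)
  then have "0 \<le> Im w" using assms(2) by simp
  then have \<phi>: "0 \<le> Arg w" "Arg w \<le> pi"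
    using Arg_le_pi[of w] Arg_eq_0 Arg_lt_pi Arg_less_0[of w] by auto
  have "point u - org = w * cis (\<theta> - pi)"
    by (simp add: w_def cis_mult mult.assoc)
  also have "\<dots> = of_real (cmod w) * cis (Arg w) * cis (\<theta> - pi)"
    by (metis rcis_cmod_Arg rcis_def)
  also have "\<dots> = of_real (cmod w) * cis (\<theta> - (pi - Arg w))"
    by (simp add: cis_mult mult.assoc algebra_simps)
  finally have "point u \<in> half_line org (\<theta> - (pi - Arg w))"
    unfolding half_line_def by (intro CollectI exI[of _ "cmod w"]) (simp add: algebra_simps)
  then show ?thesis
    unfolding wedge_def swept_region_def using \<phi> assms(1) by force
qed

section \<open>Runs of an automaton without pebbles\<close>

lemma step_without_free_port:
  assumes "free_ports V walls (position C) = {}"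
  shows "position (step V walls A C) = position C"
  using assms by (simp add: step_def Let_def split: prod.split)

text \<open>With no pebble carried or present, legality excludes \<open>Drop\<close> and
  \<open>Pick\<close> and makes the chosen port free.\<close>

lemma step_without_pebbles:
  assumes "pebble_automaton 0 A" "pebbles C = (\<lambda>_. 0)" "carried C = 0"
    "free_ports V walls (position C) \<noteq> {}"
  shows "step V walls A C =
    (let i = (free_ports V walls (position C), False, 0)
     in \<lparr>state = next_state A (state C) i,
         position = neighbour (position C) (fst (action A (state C) i)),
         pebbles = (\<lambda>_. 0), carried = 0\<rparr>)"
proof -
  let ?i = "(free_ports V walls (position C), False, 0 :: nat)"
  obtain d x where dx: "action A (state C) ?i = (d, x)" by fastforce
  have "legal_output ?i (d, x)"
    using assms(1,4) dx unfolding pebble_automaton_def by (metis order_refl)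
  then have "d \<in> free_ports V walls (position C)" "x = Keep"
    by (cases x; simp add: legal_output_def)+
  then show ?thesis
    using assms(2,3) dx by (simp add: step_def observe_def Let_def)
qed

theorem theorem7:
  fixes org :: complex and \<theta>1 \<theta>2 \<alpha> :: real and A :: "'s::finite automaton"
  assumes "clockwise_angle \<theta>1 \<theta>2 \<alpha>"
    and "large \<alpha>"
    and "pebble_automaton 0 A"
  shows "\<not> explores (wedge org \<theta>1 \<alpha>) {half_line org \<theta>1, half_line org \<theta>2} 0 A"
proof
  let ?V = "wedge org \<theta>1 \<alpha>" and ?walls = "{half_line org \<theta>1, half_line org \<theta>2}"
  assume ex: "explores ?V ?walls 0 A"
  define a b where "a = sin \<theta>1" and "b = - cos \<theta>1"
  define c where "c = Im (org * cis (pi - \<theta>1))"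
  have ab: "a \<noteq> 0 \<or> b \<noteq> 0" "\<bar>a\<bar> \<le> 1" "\<bar>b\<bar> \<le> 1"
    using sin_zero_abs_cos_one[of \<theta>1] by (auto simp: a_def b_def)
  have inV: "u \<in> ?V" if "lin a b u > c" for u
    using large_wedge_contains_half_plane[of \<alpha> org \<theta>1 u] that assms(2)
    by (simp add: large_def a_def b_def c_def)
  have nbr: "\<bar>lin a b (neighbour u d) - lin a b u\<bar> \<le> 1" for u d
    using lin_neighbour_le[OF ab(2,3)] .
  \<comment> \<open>The margin 1 keeps all neighbours in the wedge, and edges between nodes of the
    wedge are never blocked.\<close>
  have all_free: "free_ports ?V ?walls u = UNIV" if "lin a b u > c + 1" for u
  proof -
    have "u \<in> ?V" using inV that by simp
    moreover have "neighbour u d \<in> ?V" for d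
      using nbr[of u d] that by (intro inV) linarith
    ultimately show ?thesis by (simp add: free_ports_def blocked_edge_def)
  qed
  obtain u0 where u0: "u0 \<in> ?V" using unbounded_node[OF ab(1) ab(1)] inV by blast
  define C where "C t = (step ?V ?walls A ^^ t) (start_config 0 A u0)" for t
  have C_Suc: "C (Suc t) = step ?V ?walls A (C t)" for t by (simp add: C_def)
  \<comment> \<open>Legality says nothing about a node without free port, where pebbles might thus be created;
      but there the agent is stuck for ever.\<close>
  have no_pebbles: "pebbles (C t) = (\<lambda>_. 0) \<and> carried (C t) = 0 \<or>
      free_ports ?V ?walls (position (C t)) = {}" for t
  proof (induction t)
    case 0
    then show ?case by (simp add: C_def start_config_def)
  next
    case (Suc t)
    then show ?case
      using step_without_pebbles[OF assms(3), of "C t" ?V ?walls]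
        step_without_free_port[of ?V ?walls "C t" A]
      by (cases "free_ports ?V ?walls (position (C t)) = {}") (simp_all add: C_Suc Let_def)
  qed
  have "lin a b (position (C (Suc t))) \<le> lin a b (position (C t)) + 1" for t
    using nbr[of "position (C t)"]
    by (auto simp: C_Suc step_def Let_def abs_le_iff algebra_simps split: prod.split)
  \<comment> \<open>Here the input is constantly \<open>(UNIV, False, 0)\<close>, so the state
    evolves by iterating one map.\<close>
  moreover have "state (C (Suc t)) = next_state A (state (C t)) (UNIV, False, 0) \<and>
      position (C (Suc t)) =
        neighbour (position (C t)) (fst (action A (state (C t)) (UNIV, False, 0)))"
    if "lin a b (position (C t)) > c + 1" for t
    using all_free[OF that] no_pebbles[of t] step_without_pebbles[OF assms(3), of "C t" ?V ?walls]
    by (simp add: C_Suc Let_def)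
  \<comment> \<open>The run is free above \<open>c + 1\<close>, while the missed node lies above
    \<open>c\<close>, which already puts it in the wedge.\<close>
  ultimately obtain u where u: "lin a b u > c" "\<forall>t. position (C t) \<noteq> u"
    using free_run_misses_node[of a b "\<lambda>t. position (C t)" "c + 1" "\<lambda>t. state (C t)"
        "\<lambda>s. next_state A s (UNIV, False, 0)" "\<lambda>s. fst (action A s (UNIV, False, 0))" c] ab(1)
    by blast
  then show False
    using ex inV[OF u(1)] u0 unfolding explores_def C_def by blast
qed

end
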